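(* Let $n \ge 1$ and $N \ge 1$ be integers, let $A=(a_{ij}) \in \mathbb{R}^{n\times n}$ be a symmetric positive semidefinite matrix with positive diagonal ($a_{ii}>0$ for all $i$), and let $b \in \mathbb{R}^n$ be such that the linear system $Ax=b$ is solvable; let $x^\star$ denote a solution. Let $f(x)=\tfrac12 x^\top A x - b^\top x$, let $D=\mathrm{diag}(a_{11},\dots,a_{nn})$, let $L=\lambda_{\max}(D^{-1}A)$ be the largest eigenvalue of $D^{-1}A$ (all its eigenvalues are real), and let $\|u\|_D=\sqrt{\langle u,u\rangle_D}$ be the norm induced by the inner product $\langle u,v\rangle_D=\sum_{i=1}^n a_{ii}u_iv_i$ on $\mathbb{R}^n$. Let $\Delta \ge 0$ and let $x^0\in\mathbb{R}^n$ satisfy $\|x^0-x^\star\|_D^2\le \Delta$. Let $x^1,\dots,x^N$ be generated from $x^0$ by $N$ iterations of the Gauss-Seidel method, i.e., for $k=0,1,\dots,N-1$, $$x_i^{k+1}=\frac{1}{a_{ii}}\Big(b_i-\sum_{j=1}^{i-1}a_{ij}x_j^{k+1}-\sum_{j=i+1}^{n}a_{ij}x_j^{k}\Big),\qquad i=1,\dots,n.$$ Then $$f(x^N)-f(x^\star)\le \mathrm{val}(n,N,L,\Delta),$$ where $\mathrm{val}(n,N,L,\Delta)$ is the optimal value of the semidefinite performance estimation problem defined in the context.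
   Context: Definition of the semidefinite program with parameters $n,N\ge 1$ integers, $L>0$, $\Delta\ge 0$. It is the performance estimation problem for $N$ cycles ($M:=nN$ coordinate steps) of cyclic coordinate descent with unit step lengths, for convex quadratic functions, with smoothness constant $L$ and all coordinate-wise smoothness constants equal to $1$. The minimizer is placed at the origin. Put $p:=n+n(M+1)$ and for $k\in\{0,\dots,M-1\}$ let $i(k):=(k \bmod n)+1\in\{1,\dots,n\}$. Label the $p$ standard unit vectors of $\mathbb{R}^p$ as $\mathbf{x}^0_i$ ($1\le i\le n$) and $\mathbf{g}^k_i$ ($0\le k\le M$, $1\le i\le n$). Define recursively, for $0\le k\le M-1$, $$\mathbf{x}^{k+1}_i=\mathbf{x}^k_i-\mathbf{g}^k_i \ \text{ if } i=i(k),\qquad \mathbf{x}^{k+1}_i=\mathbf{x}^k_i \ \text{ otherwise},$$ and set $\mathbf{x}^\star_i=\mathbf{g}^\star_i=0\in\mathbb{R}^p$ for all $i$. The decision variables are a symmetric positive semidefinite matrix $G\in\mathbb{R}^{p\times p}$ and real numbers $f^0,\dots,f^M,f^\star$. Write $\langle u,v\rangle_G:=u^\top G v$ for $u,v\in\mathbb{R}^p$. The problem is to maximize $f^M-f^\star$ subject to $G\succeq 0$ and: (1) (convexity and $L$-smoothness) for all $r,s\in\{0,1,\dots,M,\star\}$, $$f^r\ge f^s+\sum_{i=1}^n\langle \mathbf{g}^s_i,\mathbf{x}^r_i-\mathbf{x}^s_i\rangle_G+\frac{1}{2L}\sum_{i=1}^n\langle \mathbf{g}^r_i-\mathbf{g}^s_i,\mathbf{g}^r_i-\mathbf{g}^s_i\rangle_G;$$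 (2) (quadratic function) for all $r,s\in\{0,1,\dots,M,\star\}$, $$\frac12\sum_{i=1}^n\langle \mathbf{g}^r_i-\mathbf{g}^s_i,\mathbf{x}^r_i-\mathbf{x}^s_i\rangle_G=f^r-f^s-\sum_{i=1}^n\langle \mathbf{g}^s_i,\mathbf{x}^r_i-\mathbf{x}^s_i\rangle_G;$$ (3) (coordinate-wise smoothness with constant $1$) for all $k\in\{0,\dots,M-1\}$, with $i=i(k)$, $$f^k\ge f^{k+1}+\langle \mathbf{g}^{k+1}_i,\mathbf{x}^k_i-\mathbf{x}^{k+1}_i\rangle_G+\frac12\langle \mathbf{g}^k_i-\mathbf{g}^{k+1}_i,\mathbf{g}^k_i-\mathbf{g}^{k+1}_i\rangle_G,$$ $$f^{k+1}\ge f^{k}+\langle \mathbf{g}^{k}_i,\mathbf{x}^{k+1}_i-\mathbf{x}^{k}_i\rangle_G+\frac12\langle \mathbf{g}^{k+1}_i-\mathbf{g}^{k}_i,\mathbf{g}^{k+1}_i-\mathbf{g}^{k}_i\rangle_G;$$ (4) (initial distance) $\sum_{i=1}^n\langle \mathbf{x}^0_i,\mathbf{x}^0_i\rangle_G\le\Delta$. The optimal value $\mathrm{val}(n,N,L,\Delta)$ is the supremum of $f^M-f^\star$ over all feasible $(G,f^0,\dots,f^M,f^\star)$, as an element of $[-\infty,+\infty]$. *)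

theory Defs
  imports
    "Jordan_Normal_Form.Spectral_Radius"
    "Jordan_Normal_Form.Gauss_Jordan_Elimination"
    "HOL-Library.Extended_Real"
begin

text \<open>All coordinate indices are shifted to start at 0, as usual for the matrix type used here:
  coordinates range over \<open>i < n\<close>, and the coordinate updated in step \<open>k\<close> is \<open>k mod n\<close>.\<close>

definition psd_mat :: "nat \<Rightarrow> real mat \<Rightarrow> bool" where
  "psd_mat n A \<longleftrightarrow> A \<in> carrier_mat n n \<and> transpose_mat A = A \<and>
     (\<forall>v \<in> carrier_vec n. 0 \<le> v \<bullet> (A *\<^sub>v v))"

definition diag_part :: "real mat \<Rightarrow> real mat" where
  "diag_part A = mat_diag (dim_row A) (\<lambda>i. A $$ (i, i))"

text \<open>Only real eigenvalues are collected, so this is the largest eigenvalue for matrices whose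
  complex spectrum is real and nonempty; it is unspecified if there is no real eigenvalue.\<close>

definition lambda_max :: "real mat \<Rightarrow> real" where
  "lambda_max A = Max (spectrum A)"

definition inner_D :: "real mat \<Rightarrow> real vec \<Rightarrow> real vec \<Rightarrow> real" where
  "inner_D A u v = (\<Sum>i<dim_row A. A $$ (i, i) * u $ i * v $ i)"

definition norm_D :: "real mat \<Rightarrow> real vec \<Rightarrow> real" where
  "norm_D A u = sqrt (inner_D A u u)"

definition quad_fun :: "real mat \<Rightarrow> real vec \<Rightarrow> real vec \<Rightarrow> real" where
  "quad_fun A b x = 1 / 2 * (x \<bullet> (A *\<^sub>v x)) - b \<bullet> x"

definition gauss_seidel :: "nat \<Rightarrow> real mat \<Rightarrow> real vec \<Rightarrow> nat \<Rightarrow> (nat \<Rightarrow> real vec) \<Rightarrow> bool" where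
  "gauss_seidel n A b N x \<longleftrightarrow>
     (\<forall>k\<le>N. x k \<in> carrier_vec n) \<and>
     (\<forall>k<N. \<forall>i<n. x (Suc k) $ i =
        1 / A $$ (i, i) *
          (b $ i - (\<Sum>j\<in>{0..<i}. A $$ (i, j) * x (Suc k) $ j)
                 - (\<Sum>j\<in>{Suc i..<n}. A $$ (i, j) * x k $ j)))"


definition pep_steps :: "nat \<Rightarrow> nat \<Rightarrow> nat" where
  "pep_steps n N = n * N"

definition pep_dim :: "nat \<Rightarrow> nat \<Rightarrow> nat" where
  "pep_dim n N = n + n * (pep_steps n N + 1)"

datatype pep_index = Iter nat | Star

definition pep_indices :: "nat \<Rightarrow> nat \<Rightarrow> pep_index set" where
  "pep_indices n N = insert Star (Iter ` {0..pep_steps n N})"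

text \<open>Labelling of the standard unit vectors: position \<open>i\<close> is the \<open>i\<close>-th block of the initial
  point, position \<open>n + k * n + i\<close> is the \<open>i\<close>-th block of the \<open>k\<close>-th gradient.\<close>

definition grad_iter :: "nat \<Rightarrow> nat \<Rightarrow> nat \<Rightarrow> nat \<Rightarrow> real vec" where
  "grad_iter n N k i = unit_vec (pep_dim n N) (n + k * n + i)"

primrec point_iter :: "nat \<Rightarrow> nat \<Rightarrow> nat \<Rightarrow> nat \<Rightarrow> real vec" where
  "point_iter n N 0 i = unit_vec (pep_dim n N) i"
| "point_iter n N (Suc k) i =
     (if i = k mod n then point_iter n N k i - grad_iter n N k i else point_iter n N k i)"

fun pep_g :: "nat \<Rightarrow> nat \<Rightarrow> pep_index \<Rightarrow> nat \<Rightarrow> real vec" where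
  "pep_g n N (Iter k) i = grad_iter n N k i"
| "pep_g n N Star i = 0\<^sub>v (pep_dim n N)"

fun pep_x :: "nat \<Rightarrow> nat \<Rightarrow> pep_index \<Rightarrow> nat \<Rightarrow> real vec" where
  "pep_x n N (Iter k) i = point_iter n N k i"
| "pep_x n N Star i = 0\<^sub>v (pep_dim n N)"

definition inner_G :: "real mat \<Rightarrow> real vec \<Rightarrow> real vec \<Rightarrow> real" where
  "inner_G G u v = u \<bullet> (G *\<^sub>v v)"

definition pep_smooth :: "nat \<Rightarrow> nat \<Rightarrow> real \<Rightarrow> real mat \<Rightarrow> (pep_index \<Rightarrow> real) \<Rightarrow> bool" where
  "pep_smooth n N L G f \<longleftrightarrow>
     (\<forall>r \<in> pep_indices n N. \<forall>s \<in> pep_indices n N.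
        f r \<ge> f s + (\<Sum>i<n. inner_G G (pep_g n N s i) (pep_x n N r i - pep_x n N s i))
          + 1 / (2 * L) *
            (\<Sum>i<n. inner_G G (pep_g n N r i - pep_g n N s i) (pep_g n N r i - pep_g n N s i)))"

definition pep_quadratic :: "nat \<Rightarrow> nat \<Rightarrow> real mat \<Rightarrow> (pep_index \<Rightarrow> real) \<Rightarrow> bool" where
  "pep_quadratic n N G f \<longleftrightarrow>
     (\<forall>r \<in> pep_indices n N. \<forall>s \<in> pep_indices n N.
        1 / 2 * (\<Sum>i<n. inner_G G (pep_g n N r i - pep_g n N s i) (pep_x n N r i - pep_x n N s i))
        = f r - f s - (\<Sum>i<n. inner_G G (pep_g n N s i) (pep_x n N r i - pep_x n N s i)))"

definition coord_smooth_ineq ::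
  "nat \<Rightarrow> nat \<Rightarrow> real mat \<Rightarrow> (pep_index \<Rightarrow> real) \<Rightarrow> nat \<Rightarrow> pep_index \<Rightarrow> pep_index \<Rightarrow> bool" where
  "coord_smooth_ineq n N G f i r s \<longleftrightarrow>
     f r \<ge> f s + inner_G G (pep_g n N s i) (pep_x n N r i - pep_x n N s i)
       + 1 / 2 * inner_G G (pep_g n N r i - pep_g n N s i) (pep_g n N r i - pep_g n N s i)"

definition pep_coord_smooth :: "nat \<Rightarrow> nat \<Rightarrow> real mat \<Rightarrow> (pep_index \<Rightarrow> real) \<Rightarrow> bool" where
  "pep_coord_smooth n N G f \<longleftrightarrow>
     (\<forall>k<pep_steps n N.
        coord_smooth_ineq n N G f (k mod n) (Iter k) (Iter (Suc k)) \<and>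
        coord_smooth_ineq n N G f (k mod n) (Iter (Suc k)) (Iter k))"

definition pep_initial :: "nat \<Rightarrow> nat \<Rightarrow> real \<Rightarrow> real mat \<Rightarrow> bool" where
  "pep_initial n N \<Delta> G \<longleftrightarrow>
     (\<Sum>i<n. inner_G G (pep_x n N (Iter 0) i) (pep_x n N (Iter 0) i)) \<le> \<Delta>"

definition pep_feasible ::
  "nat \<Rightarrow> nat \<Rightarrow> real \<Rightarrow> real \<Rightarrow> real mat \<Rightarrow> (pep_index \<Rightarrow> real) \<Rightarrow> bool" where
  "pep_feasible n N L \<Delta> G f \<longleftrightarrow>
     psd_mat (pep_dim n N) G \<and> pep_smooth n N L G f \<and> pep_quadratic n N G f \<and>
     pep_coord_smooth n N G f \<and> pep_initial n N \<Delta> G"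

definition pep_val :: "nat \<Rightarrow> nat \<Rightarrow> real \<Rightarrow> real \<Rightarrow> ereal" where
  "pep_val n N L \<Delta> =
     Sup {ereal (f (Iter (pep_steps n N)) - f Star) | G f. pep_feasible n N L \<Delta> G f}"

end

theory Submission
  imports Defs
begin

text \<open>Substituting \<open>y = D\<^sup>1\<^sup>/\<^sup>2 (x - x\<^sup>\<star>)\<close> turns \<open>f(x) - f(x\<^sup>\<star>)\<close> into \<open>y\<^sup>T B y / 2\<close> with
  \<open>B = D\<^sup>-\<^sup>1\<^sup>/\<^sup>2 A D\<^sup>-\<^sup>1\<^sup>/\<^sup>2\<close>, which has unit diagonal and is similar to \<open>D\<^sup>-\<^sup>1 A\<close>, and turns each
  Gauss-Seidel update into a coordinate descent step of unit length. Every block of the performance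
  estimation problem is then a single real number, so the iterates and gradients give a feasible
  Gram matrix of rank one. The smoothness constraint amounts to \<open>\<parallel>Bd\<parallel>\<^sup>2 \<le> L d\<^sup>T B d\<close>, which
  follows from \<open>B \<le> L I\<close> and the Cauchy-Schwarz inequality for the form \<open>B\<close>; the coordinate-wise
  constraints hold with equality.\<close>

section \<open>Quadratic forms of symmetric matrices\<close>

definition symmetric_mat :: "nat \<Rightarrow> real mat \<Rightarrow> bool" where
  "symmetric_mat n A \<longleftrightarrow> A \<in> carrier_mat n n \<and> A\<^sup>T = A"

lemma symmetric_mat_index:
  assumes "symmetric_mat n A" "i < n" "j < n"
  shows "A $$ (j, i) = A $$ (i, j)"
  using assms by (metis carrier_matD index_transpose_mat(1) symmetric_mat_def)

lemma symmetric_mat_carrier: "symmetric_mat n A \<Longrightarrow> A \<in> carrier_mat n n"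
  by (simp add: symmetric_mat_def)

lemma psd_mat_carrier: "psd_mat n A \<Longrightarrow> A \<in> carrier_mat n n"
  by (simp add: psd_mat_def)

lemma psd_mat_imp_symmetric_mat: "psd_mat n A \<Longrightarrow> symmetric_mat n A"
  by (simp add: psd_mat_def symmetric_mat_def)

lemma psd_mat_iff_inner_G_nonneg:
  "psd_mat n A \<longleftrightarrow> symmetric_mat n A \<and> (\<forall>v \<in> carrier_vec n. 0 \<le> inner_G A v v)"
  by (simp add: psd_mat_def symmetric_mat_def inner_G_def)

lemma psd_mat_inner_G_nonneg: "psd_mat n A \<Longrightarrow> v \<in> carrier_vec n \<Longrightarrow> 0 \<le> inner_G A v v"
  by (simp add: psd_mat_iff_inner_G_nonneg)

lemma scalar_prod_self_nonneg: "0 \<le> (v :: real vec) \<bullet> v"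
  using conjugate_square_ge_0_vec[of v] by simp

lemma scalar_prod_self_pos_iff:
  fixes v :: "real vec"
  assumes "v \<in> carrier_vec n"
  shows "0 < v \<bullet> v \<longleftrightarrow> v \<noteq> 0\<^sub>v n"
  using conjugate_square_greater_0_vec[OF assms] by simp

lemma sum_index_eq_scalar_prod:
  assumes "v \<in> carrier_vec n"
  shows "(\<Sum>i<n. u $ i * v $ i) = u \<bullet> v"
  using assms by (simp add: scalar_prod_def atLeast0LessThan)

lemma mult_mat_vec_zero:
  fixes A :: "'a :: semiring_0 mat"
  assumes "A \<in> carrier_mat m n"
  shows "A *\<^sub>v 0\<^sub>v n = 0\<^sub>v m"
  using assms by (intro eq_vecI) auto

lemma inner_G_commute:
  assumes "symmetric_mat n A" "u \<in> carrier_vec n" "v \<in> carrier_vec n"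
  shows "inner_G A u v = inner_G A v u"
proof -
  note A = symmetric_mat_carrier[OF assms(1)]
  have "inner_G A u v = (A *\<^sub>v u) \<bullet> v"
    using assms transpose_vec_mult_scalar[OF A assms(3,2)]
    by (simp add: symmetric_mat_def inner_G_def)
  also have "\<dots> = inner_G A v u"
    using comm_scalar_prod[OF mult_mat_vec_carrier[OF A assms(2)] assms(3)]
    by (simp add: inner_G_def)
  finally show ?thesis .
qed

lemma inner_G_one: "v \<in> carrier_vec n \<Longrightarrow> inner_G (1\<^sub>m n) u v = u \<bullet> v"
  by (simp add: inner_G_def)

lemma inner_G_minus_smult:
  assumes A: "symmetric_mat n A" and u: "u \<in> carrier_vec n" and v: "v \<in> carrier_vec n"
  shows "inner_G A (u - t \<cdot>\<^sub>v v) (u - t \<cdot>\<^sub>v v) =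
    inner_G A u u - 2 * t * inner_G A u v + t\<^sup>2 * inner_G A v v"
proof -
  note A_carrier = symmetric_mat_carrier[OF A]
  have "A *\<^sub>v (u - t \<cdot>\<^sub>v v) = A *\<^sub>v u - t \<cdot>\<^sub>v (A *\<^sub>v v)"
    using A_carrier u v
    by (simp add: mult_minus_distrib_mat_vec[OF A_carrier] mult_mat_vec[OF A_carrier])
  moreover have "A *\<^sub>v u \<in> carrier_vec n" "A *\<^sub>v v \<in> carrier_vec n" using A_carrier u v by auto
  ultimately show ?thesis
    using u v inner_G_commute[OF A v u]
    by (simp add: inner_G_def minus_scalar_prod_distrib[where n=n]
        scalar_prod_minus_distrib[where n=n] power2_eq_square algebra_simps)
qed

lemma half_inner_G_expand:
  assumes A: "symmetric_mat n A" and u: "u \<in> carrier_vec n" and w: "w \<in> carrier_vec n"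
  shows "1 / 2 * inner_G A u u =
    1 / 2 * inner_G A w w + (A *\<^sub>v w) \<bullet> (u - w) + 1 / 2 * inner_G A (u - w) (u - w)"
proof -
  have Aw_carrier: "A *\<^sub>v w \<in> carrier_vec n" using symmetric_mat_carrier[OF A] w by simp
  have "(A *\<^sub>v w) \<bullet> (u - w) = inner_G A u w - inner_G A w w"
    using u w Aw_carrier comm_scalar_prod[OF Aw_carrier]
    by (simp add: inner_G_def scalar_prod_minus_distrib[where n=n])
  moreover have "inner_G A (u - w) (u - w) = inner_G A u u - 2 * inner_G A u w + inner_G A w w"
    using inner_G_minus_smult[OF A u w, of 1] by simp
  ultimately show ?thesis by (simp add: algebra_simps)
qed

lemma quad_fun_minus_stationary:
  assumes A: "symmetric_mat n A" and x: "x \<in> carrier_vec n" and z: "z \<in> carrier_vec n"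
  shows "quad_fun A (A *\<^sub>v z) x - quad_fun A (A *\<^sub>v z) z = 1 / 2 * inner_G A (x - z) (x - z)"
proof -
  have "A *\<^sub>v z \<in> carrier_vec n" using symmetric_mat_carrier[OF A] z by simp
  then show ?thesis
    using half_inner_G_expand[OF A x z] scalar_prod_minus_distrib[of "A *\<^sub>v z" n x z] x z
    unfolding quad_fun_def inner_G_def by linarith
qed

lemma nonneg_quadratic_imp_discriminant_le:
  fixes a c d :: real
  assumes nonneg: "\<And>t. 0 \<le> a - 2 * t * c + t\<^sup>2 * d" and "0 \<le> d"
  shows "c\<^sup>2 \<le> a * d"
proof (cases "d = 0")
  case True
  have "c = 0"
  proof (rule ccontr)
    assume "c \<noteq> 0"
    then show False using nonneg[of "(a + 1) / (2 * c)"] True by simp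
  qed
  then show ?thesis using True by simp
next
  case False
  then have "0 < d" using \<open>0 \<le> d\<close> by simp
  then have "a - 2 * (c / d) * c + (c / d)\<^sup>2 * d = a - c\<^sup>2 / d"
    by (simp add: field_simps power2_eq_square)
  then have "c\<^sup>2 / d \<le> a" using nonneg[of "c / d"] by simp
  then show ?thesis using \<open>0 < d\<close> by (simp add: pos_divide_le_eq)
qed

lemma psd_mat_Cauchy_Schwarz:
  assumes A: "psd_mat n A" and u: "u \<in> carrier_vec n" and v: "v \<in> carrier_vec n"
  shows "(inner_G A u v)\<^sup>2 \<le> inner_G A u u * inner_G A v v"
proof (rule nonneg_quadratic_imp_discriminant_le)
  show "0 \<le> inner_G A u u - 2 * t * inner_G A u v + t\<^sup>2 * inner_G A v v" for t
    using psd_mat_inner_G_nonneg[OF A, of "u - t \<cdot>\<^sub>v v"] u v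
      inner_G_minus_smult[OF psd_mat_imp_symmetric_mat[OF A] u v, of t] by simp
  show "0 \<le> inner_G A v v" by (rule psd_mat_inner_G_nonneg[OF A v])
qed

lemma psd_mat_one: "psd_mat n (1\<^sub>m n)"
  by (simp add: psd_mat_def scalar_prod_self_nonneg)

lemma scalar_prod_Cauchy_Schwarz:
  fixes u v :: "real vec"
  assumes "u \<in> carrier_vec n" "v \<in> carrier_vec n"
  shows "(u \<bullet> v)\<^sup>2 \<le> (u \<bullet> u) * (v \<bullet> v)"
  using psd_mat_Cauchy_Schwarz[OF psd_mat_one assms] assms by (simp add: inner_G_one)

lemma norm_mult_mat_vec_le_frobenius:
  fixes A :: "real mat"
  assumes A: "A \<in> carrier_mat m n" and v: "v \<in> carrier_vec n"
  shows "(A *\<^sub>v v) \<bullet> (A *\<^sub>v v) \<le> (\<Sum>i<m. row A i \<bullet> row A i) * (v \<bullet> v)"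
proof -
  have "(A *\<^sub>v v) \<bullet> (A *\<^sub>v v) = (\<Sum>i<m. (row A i \<bullet> v)\<^sup>2)"
    using A by (simp add: scalar_prod_def[of "A *\<^sub>v v"] power2_eq_square atLeast0LessThan)
  also have "\<dots> \<le> (\<Sum>i<m. (row A i \<bullet> row A i) * (v \<bullet> v))"
    using A v by (intro sum_mono scalar_prod_Cauchy_Schwarz[where n=n]) auto
  finally show ?thesis by (simp add: sum_distrib_right)
qed

section \<open>The largest eigenvalue of a symmetric matrix\<close>

definition rayleigh_bound :: "nat \<Rightarrow> real mat \<Rightarrow> real \<Rightarrow> bool" where
  "rayleigh_bound n A c \<longleftrightarrow> (\<forall>v \<in> carrier_vec n. inner_G A v v \<le> c * (v \<bullet> v))"

lemma rayleigh_boundD: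
  "rayleigh_bound n A c \<Longrightarrow> v \<in> carrier_vec n \<Longrightarrow> inner_G A v v \<le> c * (v \<bullet> v)"
  by (simp add: rayleigh_bound_def)

lemma rayleigh_bound_ge_diagonal:
  assumes "rayleigh_bound n A c" "A \<in> carrier_mat n n" "i < n"
  shows "A $$ (i, i) \<le> c"
  using rayleigh_boundD[OF assms(1), of "unit_vec n i"] assms(2,3) by (simp add: inner_G_def)

lemma ex_rayleigh_bound:
  assumes A: "A \<in> carrier_mat n n"
  shows "\<exists>c. rayleigh_bound n A c"
proof -
  let ?C = "\<Sum>i<n. row A i \<bullet> row A i"
  have "inner_G A v v \<le> (1 + ?C) / 2 * (v \<bullet> v)" if v: "v \<in> carrier_vec n" for v
  proof -
    have Av_carrier: "A *\<^sub>v v \<in> carrier_vec n" using A v by simp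
    have "0 \<le> v \<bullet> v - 2 * inner_G A v v + (A *\<^sub>v v) \<bullet> (A *\<^sub>v v)"
      using inner_G_minus_smult[OF psd_mat_imp_symmetric_mat[OF psd_mat_one] v Av_carrier, of 1]
        v Av_carrier scalar_prod_self_nonneg[of "v - A *\<^sub>v v"]
      by (simp add: inner_G_def)
    then show ?thesis
      using norm_mult_mat_vec_le_frobenius[OF A v] by (simp add: field_simps)
  qed
  then show ?thesis unfolding rayleigh_bound_def by blast
qed

lemma least_rayleigh_bound:
  assumes A: "A \<in> carrier_mat n n" and "0 < n"
  obtains \<mu> where "rayleigh_bound n A \<mu>" and "\<And>c. rayleigh_bound n A c \<Longrightarrow> \<mu> \<le> c"
proof
  define bounds where "bounds = {c. rayleigh_bound n A c}"
  have "bounds \<noteq> {}" using ex_rayleigh_bound[OF A] by (simp add: bounds_def)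
  have below: "bdd_below bounds"
    using rayleigh_bound_ge_diagonal[OF _ A \<open>0 < n\<close>] by (auto simp: bounds_def bdd_below_def)
  show "rayleigh_bound n A (Inf bounds)" unfolding rayleigh_bound_def
  proof
    fix v :: "real vec" assume v: "v \<in> carrier_vec n"
    show "inner_G A v v \<le> Inf bounds * (v \<bullet> v)"
    proof (cases "v = 0\<^sub>v n")
      case True
      then show ?thesis using A by (simp add: inner_G_def)
    next
      case False
      then have pos: "0 < v \<bullet> v" using v by (simp add: scalar_prod_self_pos_iff)
      have "inner_G A v v / (v \<bullet> v) \<le> c" if "c \<in> bounds" for c
        using that pos rayleigh_boundD[of n A c, OF _ v] by (simp add: bounds_def pos_divide_le_eq)
      then have "inner_G A v v / (v \<bullet> v) \<le> Inf bounds" using \<open>bounds \<noteq> {}\<close> by (intro cInf_greatest)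
      then show ?thesis using pos by (simp add: pos_divide_le_eq)
    qed
  qed
  show "Inf bounds \<le> c" if "rayleigh_bound n A c" for c
    using that below by (intro cInf_lower) (simp_all add: bounds_def)
qed

lemma psd_mat_image_norm_le:
  assumes A: "psd_mat n A" and bound: "rayleigh_bound n A c" and v: "v \<in> carrier_vec n"
  shows "(A *\<^sub>v v) \<bullet> (A *\<^sub>v v) \<le> c * inner_G A v v"
proof (cases "A *\<^sub>v v = 0\<^sub>v n")
  case True
  then show ?thesis using v by (simp add: inner_G_def)
next
  case False
  define w where "w = A *\<^sub>v v"
  have w_carrier: "w \<in> carrier_vec n" using psd_mat_carrier[OF A] v by (simp add: w_def)
  have "inner_G A v w = w \<bullet> w"
    using inner_G_commute[OF psd_mat_imp_symmetric_mat[OF A] v w_carrier]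
    by (simp add: inner_G_def w_def)
  then have "(w \<bullet> w)\<^sup>2 \<le> inner_G A v v * inner_G A w w"
    using psd_mat_Cauchy_Schwarz[OF A v w_carrier] by simp
  also have "\<dots> \<le> inner_G A v v * (c * (w \<bullet> w))"
    using rayleigh_boundD[OF bound w_carrier] psd_mat_inner_G_nonneg[OF A v]
    by (rule mult_left_mono)
  finally have "(w \<bullet> w) * (w \<bullet> w) \<le> (c * inner_G A v v) * (w \<bullet> w)"
    by (simp add: power2_eq_square ac_simps)
  moreover have "0 < w \<bullet> w" using False w_carrier by (simp add: scalar_prod_self_pos_iff w_def)
  ultimately show ?thesis by (simp flip: w_def)
qed

lemma psd_mat_cocoercive:
  assumes A: "psd_mat n A" and bound: "rayleigh_bound n A L" and v: "v \<in> carrier_vec n"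
  shows "1 / (2 * L) * ((A *\<^sub>v v) \<bullet> (A *\<^sub>v v)) \<le> 1 / 2 * inner_G A v v"
proof (cases "L > 0")
  case True
  then show ?thesis using psd_mat_image_norm_le[OF A bound v] by (simp add: field_simps)
next
  case False \<comment> \<open>This includes \<open>L = 0\<close>, where the factor \<open>1 / (2 * L)\<close> is \<open>0\<close>.\<close>
  then have "1 / (2 * L) * ((A *\<^sub>v v) \<bullet> (A *\<^sub>v v)) \<le> 0"
    by (intro mult_nonpos_nonneg scalar_prod_self_nonneg) simp
  then show ?thesis using psd_mat_inner_G_nonneg[OF A v] by linarith
qed

lemma nonsingular_psd_mat_coercive:
  assumes A: "psd_mat n A" and det: "det A \<noteq> 0"
  obtains e where "0 < e" and "\<And>v. v \<in> carrier_vec n \<Longrightarrow> e * (v \<bullet> v) \<le> inner_G A v v"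
proof -
  note A_carrier = psd_mat_carrier[OF A]
  obtain W where left_inverse: "W \<in> carrier_mat n n" "W * A = 1\<^sub>m n"
    using det_non_zero_imp_unit[OF A_carrier det] by (auto simp: Units_def ring_mat_def)
  obtain c where bound: "rayleigh_bound n A c" using ex_rayleigh_bound[OF A_carrier] by blast
  define K where "K = (\<Sum>i<n. row W i \<bullet> row W i)"
  have "0 \<le> K" unfolding K_def by (intro sum_nonneg scalar_prod_self_nonneg)
  have "1 / (\<bar>K * c\<bar> + 1) * (v \<bullet> v) \<le> inner_G A v v" if v: "v \<in> carrier_vec n" for v
  proof -
    have Av_carrier: "A *\<^sub>v v \<in> carrier_vec n" using A_carrier v by simp
    have "v = W *\<^sub>v (A *\<^sub>v v)"
      using left_inverse v by (simp flip: assoc_mult_mat_vec[OF left_inverse(1) A_carrier v])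
    then have "v \<bullet> v \<le> K * ((A *\<^sub>v v) \<bullet> (A *\<^sub>v v))"
      using norm_mult_mat_vec_le_frobenius[OF left_inverse(1) Av_carrier] by (simp add: K_def)
    also have "\<dots> \<le> K * (c * inner_G A v v)"
      using psd_mat_image_norm_le[OF A bound v] \<open>0 \<le> K\<close> by (rule mult_left_mono)
    also have "\<dots> = (K * c) * inner_G A v v" by simp
    also have "\<dots> \<le> (\<bar>K * c\<bar> + 1) * inner_G A v v"
      using psd_mat_inner_G_nonneg[OF A v] by (intro mult_right_mono) auto
    finally show ?thesis by (simp add: pos_divide_le_eq mult.commute)
  qed
  moreover have "0 < 1 / (\<bar>K * c\<bar> + 1)" by simp
  ultimately show ?thesis using that by blast
qed

lemma smult_one_minus_mult_vec:
  fixes A :: "real mat"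
  assumes A: "A \<in> carrier_mat n n" and v: "v \<in> carrier_vec n"
  shows "(c \<cdot>\<^sub>m 1\<^sub>m n - A) *\<^sub>v v = c \<cdot>\<^sub>v v - A *\<^sub>v v"
proof -
  have "(c \<cdot>\<^sub>m 1\<^sub>m n) *\<^sub>v v = c \<cdot>\<^sub>v v" using v by (intro eq_vecI) (auto simp: row_smult)
  then show ?thesis using A v by (simp add: minus_mult_distrib_mat_vec[where nr=n and nc=n])
qed

lemma inner_G_smult_one_minus:
  assumes A: "A \<in> carrier_mat n n" and v: "v \<in> carrier_vec n"
  shows "inner_G (c \<cdot>\<^sub>m 1\<^sub>m n - A) v v = c * (v \<bullet> v) - inner_G A v v"
  using assms
  by (simp add: inner_G_def smult_one_minus_mult_vec scalar_prod_minus_distrib[where n=n])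

lemma psd_mat_smult_one_minus_iff:
  assumes A: "symmetric_mat n A"
  shows "psd_mat n (c \<cdot>\<^sub>m 1\<^sub>m n - A) \<longleftrightarrow> rayleigh_bound n A c"
proof -
  note A_carrier = symmetric_mat_carrier[OF A]
  have "symmetric_mat n (c \<cdot>\<^sub>m 1\<^sub>m n - A)"
    unfolding symmetric_mat_def
  proof
    show "c \<cdot>\<^sub>m 1\<^sub>m n - A \<in> carrier_mat n n" using A_carrier by (rule minus_carrier_mat)
    show "(c \<cdot>\<^sub>m 1\<^sub>m n - A)\<^sup>T = c \<cdot>\<^sub>m 1\<^sub>m n - A"
      using A_carrier symmetric_mat_index[OF A] by (intro eq_matI) auto
  qed
  then show ?thesis
    using A_carrier
    by (simp add: psd_mat_iff_inner_G_nonneg inner_G_smult_one_minus rayleigh_bound_def)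
qed

text \<open>Otherwise \<open>\<mu>I - A\<close> would be nonsingular, hence would dominate a positive multiple of the
  identity, and \<open>\<mu>\<close> could be decreased.\<close>

lemma least_rayleigh_bound_eigenvalue:
  assumes A: "symmetric_mat n A" and bound: "rayleigh_bound n A \<mu>"
    and least: "\<And>c. rayleigh_bound n A c \<Longrightarrow> \<mu> \<le> c"
  shows "eigenvalue A \<mu>"
proof -
  note A_carrier = symmetric_mat_carrier[OF A]
  define M where "M = \<mu> \<cdot>\<^sub>m 1\<^sub>m n - A"
  have M_psd: "psd_mat n M" using bound by (simp add: M_def psd_mat_smult_one_minus_iff[OF A])
  have "det M = 0"
  proof (rule ccontr)
    assume "det M \<noteq> 0"
    then obtain e where "0 < e"
      and coercive: "\<And>v. v \<in> carrier_vec n \<Longrightarrow> e * (v \<bullet> v) \<le> inner_G M v v"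
      using nonsingular_psd_mat_coercive[OF M_psd] by blast
    have "rayleigh_bound n A (\<mu> - e)"
      unfolding rayleigh_bound_def
    proof
      fix v :: "real vec" assume v: "v \<in> carrier_vec n"
      then show "inner_G A v v \<le> (\<mu> - e) * (v \<bullet> v)"
        using coercive[OF v] inner_G_smult_one_minus[OF A_carrier v, of \<mu>]
        by (simp add: M_def left_diff_distrib)
    qed
    then show False using least[of "\<mu> - e"] \<open>0 < e\<close> by simp
  qed
  then obtain v where kernel: "v \<in> carrier_vec n" "v \<noteq> 0\<^sub>v n" "M *\<^sub>v v = 0\<^sub>v n"
    using det_0_iff_vec_prod_zero[OF psd_mat_carrier[OF M_psd]] by blast
  then have "A *\<^sub>v v = \<mu> \<cdot>\<^sub>v v"
    using smult_one_minus_mult_vec[OF A_carrier kernel(1), of \<mu>] A_carrier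
    by (auto simp: M_def vec_eq_iff)
  then show ?thesis using kernel A_carrier by (auto simp: eigenvalue_def eigenvector_def)
qed

lemma rayleigh_bound_lambda_max:
  assumes A: "symmetric_mat n A" and n_pos: "0 < n"
  shows "rayleigh_bound n A (lambda_max A)"
proof -
  note A_carrier = symmetric_mat_carrier[OF A]
  obtain \<mu> where least: "rayleigh_bound n A \<mu>" "\<And>c. rayleigh_bound n A c \<Longrightarrow> \<mu> \<le> c"
    using least_rayleigh_bound[OF A_carrier n_pos] by blast
  then have "\<mu> \<in> spectrum A"
    using least_rayleigh_bound_eigenvalue[OF A] by (simp add: spectrum_def)
  then have "\<mu> \<le> lambda_max A"
    using card_finite_spectrum(1)[OF A_carrier] by (simp add: lambda_max_def)
  then show ?thesis
    using least(1) unfolding rayleigh_bound_def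
    by (meson mult_right_mono order_trans scalar_prod_self_nonneg)
qed

lemma spectrum_similar:
  fixes A B :: "'a :: field mat"
  assumes "similar_mat A B"
  shows "spectrum A = spectrum B"
proof -
  obtain n where "A \<in> carrier_mat n n" "B \<in> carrier_mat n n"
    using similar_matD[OF assms] by auto
  then show ?thesis
    by (simp add: spectrum_root_char_poly char_poly_similar[OF assms])
qed

section \<open>Symmetric diagonal scaling\<close>

lemma inner_G_congruence:
  assumes A: "A \<in> carrier_mat m m" and P: "P \<in> carrier_mat m n"
    and u: "u \<in> carrier_vec n" and v: "v \<in> carrier_vec n"
  shows "inner_G (P\<^sup>T * A * P) u v = inner_G A (P *\<^sub>v u) (P *\<^sub>v v)"
proof -
  have Pv_carrier: "P *\<^sub>v v \<in> carrier_vec m" using A P v by auto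
  have "inner_G (P\<^sup>T * A * P) u v = u \<bullet> (P\<^sup>T *\<^sub>v (A *\<^sub>v (P *\<^sub>v v)))"
    using A P v Pv_carrier by (simp add: inner_G_def assoc_mult_mat[where n\<^sub>1=n and n\<^sub>2=m and n\<^sub>3=m]
        assoc_mult_mat_vec[where n\<^sub>1=n and n\<^sub>2=m and n\<^sub>3=n] assoc_mult_mat_vec[OF A P v])
  also have "\<dots> = inner_G A (P *\<^sub>v u) (P *\<^sub>v v)"
    using A P u Pv_carrier transpose_vec_mult_scalar[OF P u, of "A *\<^sub>v (P *\<^sub>v v)"]
    by (simp add: inner_G_def comm_scalar_prod[where n=n] comm_scalar_prod[where n=m])
  finally show ?thesis .
qed

lemma psd_mat_congruence:
  assumes A: "psd_mat m A" and P: "P \<in> carrier_mat m n"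
  shows "psd_mat n (P\<^sup>T * A * P)"
proof -
  note A_carrier = psd_mat_carrier[OF A]
  have transpose_A: "A\<^sup>T = A" using A by (simp add: psd_mat_def)
  have "(P\<^sup>T * A * P)\<^sup>T = P\<^sup>T * A * P"
    using A_carrier P transpose_mult[of "P\<^sup>T * A" n m P n] transpose_mult[of "P\<^sup>T" n m A m]
    by (simp add: transpose_A assoc_mult_mat[of "P\<^sup>T" n m A m P n])
  moreover have "P\<^sup>T * A * P \<in> carrier_mat n n" using A_carrier P by simp
  ultimately show ?thesis
    using psd_mat_inner_G_nonneg[OF A] P
    by (simp add: psd_mat_iff_inner_G_nonneg symmetric_mat_def inner_G_congruence[OF A_carrier P])
qed

lemma transpose_mat_diag: "(mat_diag n d)\<^sup>T = mat_diag n d"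
  by (auto simp: mat_diag_def)

lemma mat_diag_mult_vec:
  fixes d :: "nat \<Rightarrow> 'a :: comm_semiring_1"
  assumes "v \<in> carrier_vec n"
  shows "mat_diag n d *\<^sub>v v = vec n (\<lambda>i. d i * v $ i)"
proof -
  have "row (mat_diag n d) i = d i \<cdot>\<^sub>v unit_vec n i" if "i < n" for i
    using that by (intro eq_vecI) (auto simp: mat_diag_def)
  then show ?thesis using assms by (intro eq_vecI) (auto simp: mat_diag_def)
qed

lemma mat_diag_eq_one:
  assumes "\<And>i. i < n \<Longrightarrow> d i = 1"
  shows "mat_diag n d = 1\<^sub>m n"
  using assms by (auto simp: mat_diag_def)

lemma mat_inverse_eq_Some:
  fixes A :: "'a :: field mat"
  assumes A: "A \<in> carrier_mat n n" and B: "B \<in> carrier_mat n n" and right_inverse: "A * B = 1\<^sub>m n"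
  shows "mat_inverse A = Some B"
proof -
  have left_inverse: "B * A = 1\<^sub>m n" using mat_mult_left_right_inverse[OF A B right_inverse] .
  have "A \<in> Units (ring_mat TYPE('a) n ())"
    using A B right_inverse left_inverse by (auto simp: Units_def ring_mat_def)
  then obtain W where inverse_W: "mat_inverse A = Some W" using mat_inverse(1)[OF A] by fastforce
  then have "W * A = 1\<^sub>m n" "W \<in> carrier_mat n n" using mat_inverse(2)[OF A] by auto
  then have "W = B"
    using assoc_mult_mat[OF _ A B] right_inverse B by (metis left_mult_one_mat right_mult_one_mat)
  then show ?thesis using inverse_W by simp
qed

definition sqrt_diag :: "real mat \<Rightarrow> real mat" where
  "sqrt_diag A = mat_diag (dim_row A) (\<lambda>i. sqrt (A $$ (i, i)))"

definition inv_sqrt_diag :: "real mat \<Rightarrow> real mat" where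
  "inv_sqrt_diag A = mat_diag (dim_row A) (\<lambda>i. 1 / sqrt (A $$ (i, i)))"

definition jacobi_scaled :: "real mat \<Rightarrow> real mat" where
  "jacobi_scaled A = inv_sqrt_diag A * A * inv_sqrt_diag A"

lemma jacobi_scaled_eq_congruence:
  "jacobi_scaled A = (inv_sqrt_diag A)\<^sup>T * A * inv_sqrt_diag A"
  by (simp add: jacobi_scaled_def inv_sqrt_diag_def transpose_mat_diag)

lemma sqrt_diag_carrier: "A \<in> carrier_mat n n \<Longrightarrow> sqrt_diag A \<in> carrier_mat n n"
  by (simp add: sqrt_diag_def)

lemma inv_sqrt_diag_carrier: "A \<in> carrier_mat n n \<Longrightarrow> inv_sqrt_diag A \<in> carrier_mat n n"
  by (simp add: inv_sqrt_diag_def)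

lemma jacobi_scaled_carrier: "A \<in> carrier_mat n n \<Longrightarrow> jacobi_scaled A \<in> carrier_mat n n"
  by (simp add: jacobi_scaled_def inv_sqrt_diag_carrier mult_carrier_mat[where n=n])

context
  fixes n :: nat and A :: "real mat"
  assumes A: "A \<in> carrier_mat n n" and diagonal_pos: "\<And>i. i < n \<Longrightarrow> 0 < A $$ (i, i)"
begin

lemma sqrt_diag_mult_inv_sqrt_diag: "sqrt_diag A * inv_sqrt_diag A = 1\<^sub>m n"
  using A diagonal_pos
  by (auto simp: sqrt_diag_def inv_sqrt_diag_def less_imp_neq[symmetric] intro!: mat_diag_eq_one)

lemma inv_sqrt_diag_mult_sqrt_diag: "inv_sqrt_diag A * sqrt_diag A = 1\<^sub>m n"
  using mat_mult_left_right_inverse[OF sqrt_diag_carrier[OF A] inv_sqrt_diag_carrier[OF A]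
      sqrt_diag_mult_inv_sqrt_diag] .

lemma mat_inverse_diag_part:
  "mat_inverse (diag_part A) = Some (inv_sqrt_diag A * inv_sqrt_diag A)"
proof (rule mat_inverse_eq_Some)
  show "diag_part A \<in> carrier_mat n n" using A by (simp add: diag_part_def)
  show "inv_sqrt_diag A * inv_sqrt_diag A \<in> carrier_mat n n"
    using inv_sqrt_diag_carrier[OF A] by simp
  show "diag_part A * (inv_sqrt_diag A * inv_sqrt_diag A) = 1\<^sub>m n"
    using A diagonal_pos
    by (auto simp: diag_part_def inv_sqrt_diag_def abs_of_pos less_imp_neq[symmetric]
        intro!: mat_diag_eq_one)
qed

lemma jacobi_scaled_diagonal:
  assumes "i < n"
  shows "jacobi_scaled A $$ (i, i) = 1"
proof -
  have "jacobi_scaled A $$ (i, i) = A $$ (i, i) / (sqrt (A $$ (i, i)) * sqrt (A $$ (i, i)))"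
    using A assms mat_diag_mult_right[of "inv_sqrt_diag A * A" n n]
    by (simp add: jacobi_scaled_def inv_sqrt_diag_def mat_diag_mult_left[OF A])
  then show ?thesis using diagonal_pos[OF assms] by simp
qed

lemma similar_mat_jacobi_scaled:
  "similar_mat (the (mat_inverse (diag_part A)) * A) (jacobi_scaled A)"
proof (rule similar_matI)
  note inv_carrier = inv_sqrt_diag_carrier[OF A] and sqrt_carrier = sqrt_diag_carrier[OF A]
  show "{the (mat_inverse (diag_part A)) * A, jacobi_scaled A, inv_sqrt_diag A, sqrt_diag A}
      \<subseteq> carrier_mat n n"
    using A inv_carrier sqrt_carrier jacobi_scaled_carrier[OF A]
    by (simp add: mat_inverse_diag_part)
  have "inv_sqrt_diag A * jacobi_scaled A * sqrt_diag A
      = inv_sqrt_diag A * inv_sqrt_diag A * A * (inv_sqrt_diag A * sqrt_diag A)"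
    using A inv_carrier sqrt_carrier
    by (simp add: jacobi_scaled_def
        assoc_mult_mat[where n\<^sub>1=n and n\<^sub>2=n and n\<^sub>3=n and n\<^sub>4=n])
  then show "the (mat_inverse (diag_part A)) * A = inv_sqrt_diag A * jacobi_scaled A * sqrt_diag A"
    using A inv_carrier by (simp add: inv_sqrt_diag_mult_sqrt_diag mat_inverse_diag_part)
qed (fact inv_sqrt_diag_mult_sqrt_diag sqrt_diag_mult_inv_sqrt_diag)+

lemma lambda_max_jacobi_scaled:
  "lambda_max (the (mat_inverse (diag_part A)) * A) = lambda_max (jacobi_scaled A)"
  by (simp add: lambda_max_def spectrum_similar[OF similar_mat_jacobi_scaled])

lemma inv_sqrt_diag_sqrt_diag_vec:
  assumes "v \<in> carrier_vec n"
  shows "inv_sqrt_diag A *\<^sub>v (sqrt_diag A *\<^sub>v v) = v"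
  using assms assoc_mult_mat_vec[OF inv_sqrt_diag_carrier[OF A] sqrt_diag_carrier[OF A] assms]
  by (simp add: inv_sqrt_diag_mult_sqrt_diag)

lemma inner_G_jacobi_scaled:
  assumes u: "u \<in> carrier_vec n" and v: "v \<in> carrier_vec n"
  shows "inner_G (jacobi_scaled A) (sqrt_diag A *\<^sub>v u) (sqrt_diag A *\<^sub>v v) = inner_G A u v"
  using inner_G_congruence[OF A inv_sqrt_diag_carrier[OF A],
      of "sqrt_diag A *\<^sub>v u" "sqrt_diag A *\<^sub>v v"]
    sqrt_diag_carrier[OF A] u v
  by (simp add: jacobi_scaled_eq_congruence inv_sqrt_diag_sqrt_diag_vec)

lemma sqrt_diag_mult_unit_vec:
  assumes "i < n"
  shows "sqrt_diag A *\<^sub>v unit_vec n i = sqrt (A $$ (i, i)) \<cdot>\<^sub>v unit_vec n i"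
  using A assms by (intro eq_vecI) (auto simp: sqrt_diag_def mat_diag_mult_vec)

lemma jacobi_scaled_mult_sqrt_diag_vec_index:
  assumes v: "v \<in> carrier_vec n" and i: "i < n"
  shows "(jacobi_scaled A *\<^sub>v (sqrt_diag A *\<^sub>v v)) $ i = (A *\<^sub>v v) $ i / sqrt (A $$ (i, i))"
proof -
  have "jacobi_scaled A *\<^sub>v (sqrt_diag A *\<^sub>v v) = inv_sqrt_diag A *\<^sub>v (A *\<^sub>v v)"
    using A v inv_sqrt_diag_carrier[OF A] sqrt_diag_carrier[OF A]
    by (simp add: jacobi_scaled_def inv_sqrt_diag_sqrt_diag_vec
        assoc_mult_mat_vec[where n\<^sub>1=n and n\<^sub>2=n and n\<^sub>3=n])
  moreover have "A *\<^sub>v v \<in> carrier_vec n" using A v by simp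
  ultimately show ?thesis
    using A i by (simp add: inv_sqrt_diag_def mat_diag_mult_vec del: index_mult_mat_vec)
qed

lemma sqrt_diag_vec_scalar_prod:
  assumes u: "u \<in> carrier_vec n" and v: "v \<in> carrier_vec n"
  shows "(sqrt_diag A *\<^sub>v u) \<bullet> (sqrt_diag A *\<^sub>v v) = inner_D A u v"
  using A u v diagonal_pos unfolding inner_D_def scalar_prod_def
  by (auto simp: sqrt_diag_def mat_diag_mult_vec atLeast0LessThan less_imp_le intro!: sum.cong)

lemma norm_D_square:
  assumes v: "v \<in> carrier_vec n"
  shows "(norm_D A v)\<^sup>2 = (sqrt_diag A *\<^sub>v v) \<bullet> (sqrt_diag A *\<^sub>v v)"
  using sqrt_diag_vec_scalar_prod[OF v v] scalar_prod_self_nonneg[of "sqrt_diag A *\<^sub>v v"]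
  by (simp add: norm_D_def)

end

section \<open>Cyclic coordinate descent\<close>

definition cyclic_coordinate_descent :: "nat \<Rightarrow> real mat \<Rightarrow> nat \<Rightarrow> (nat \<Rightarrow> real vec) \<Rightarrow> bool" where
  "cyclic_coordinate_descent n A M y \<longleftrightarrow> y 0 \<in> carrier_vec n \<and>
     (\<forall>k<M. let i = k mod n in
        y (Suc k) = y k - ((A *\<^sub>v y k) $ i / A $$ (i, i)) \<cdot>\<^sub>v unit_vec n i)"

lemma cyclic_coordinate_descent_carrier:
  assumes "cyclic_coordinate_descent n A M y" "k \<le> M"
  shows "y k \<in> carrier_vec n"
  using assms
  by (cases k) (auto simp: cyclic_coordinate_descent_def Let_def Suc_le_eq intro!: carrier_vecI)

lemma cyclic_coordinate_descent_jacobi_scaled: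
  assumes A: "A \<in> carrier_mat n n" and diagonal_pos: "\<And>i. i < n \<Longrightarrow> 0 < A $$ (i, i)"
    and "0 < n" and descent: "cyclic_coordinate_descent n A M y"
  shows "cyclic_coordinate_descent n (jacobi_scaled A) M (\<lambda>k. sqrt_diag A *\<^sub>v y k)"
  unfolding cyclic_coordinate_descent_def Let_def
proof (intro conjI allI impI)
  note sqrt_carrier = sqrt_diag_carrier[OF A]
  note y_carrier = cyclic_coordinate_descent_carrier[OF descent]
  show "sqrt_diag A *\<^sub>v y 0 \<in> carrier_vec n" using sqrt_carrier y_carrier by simp
  fix k assume "k < M"
  define i where "i = k mod n"
  define c where "c = (A *\<^sub>v y k) $ i / A $$ (i, i)"
  have "i < n" using \<open>0 < n\<close> by (simp add: i_def)
  have yk_carrier: "y k \<in> carrier_vec n" using y_carrier \<open>k < M\<close> by simp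
  have "y (Suc k) = y k - c \<cdot>\<^sub>v unit_vec n i"
    using descent \<open>k < M\<close> by (simp add: cyclic_coordinate_descent_def Let_def i_def c_def)
  then have "sqrt_diag A *\<^sub>v y (Suc k)
      = sqrt_diag A *\<^sub>v y k - (c * sqrt (A $$ (i, i))) \<cdot>\<^sub>v unit_vec n i"
    using sqrt_carrier yk_carrier sqrt_diag_mult_unit_vec[OF A diagonal_pos \<open>i < n\<close>]
    by (simp add: mult_minus_distrib_mat_vec[OF sqrt_carrier] mult_mat_vec[OF sqrt_carrier]
        smult_smult_assoc)
  moreover have "c * sqrt (A $$ (i, i)) = (A *\<^sub>v y k) $ i / sqrt (A $$ (i, i))"
    using diagonal_pos[OF \<open>i < n\<close>] by (simp add: c_def field_simps del: index_mult_mat_vec)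
  then have "c * sqrt (A $$ (i, i))
      = (jacobi_scaled A *\<^sub>v (sqrt_diag A *\<^sub>v y k)) $ i / jacobi_scaled A $$ (i, i)"
    using jacobi_scaled_mult_sqrt_diag_vec_index[OF A diagonal_pos yk_carrier \<open>i < n\<close>]
      jacobi_scaled_diagonal[OF A diagonal_pos \<open>i < n\<close>] by simp
  ultimately show "sqrt_diag A *\<^sub>v y (Suc k) = sqrt_diag A *\<^sub>v y k
      - ((jacobi_scaled A *\<^sub>v (sqrt_diag A *\<^sub>v y k)) $ (k mod n)
         / jacobi_scaled A $$ (k mod n, k mod n)) \<cdot>\<^sub>v unit_vec n (k mod n)"
    by (simp add: i_def)
qed

definition sweep_point :: "nat \<Rightarrow> (nat \<Rightarrow> real vec) \<Rightarrow> nat \<Rightarrow> real vec" where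
  "sweep_point n x t =
     vec n (\<lambda>j. if j < t mod n then x (Suc (t div n)) $ j else x (t div n) $ j)"

lemma sweep_point_carrier: "sweep_point n x t \<in> carrier_vec n"
  by (simp add: sweep_point_def)

lemma sweep_point_full_sweep:
  assumes "x k \<in> carrier_vec n"
  shows "sweep_point n x (n * k) = x k"
  using assms by (cases "n = 0") (auto simp: sweep_point_def)

lemma sweep_point_Suc_index:
  assumes "j < n"
  shows "sweep_point n x (Suc t) $ j =
    (if j = t mod n then x (Suc (t div n)) $ j else sweep_point n x t $ j)"
  using assms by (auto simp: sweep_point_def mod_Suc div_Suc)

lemma gauss_seidel_coordinate_update:
  assumes iterates: "gauss_seidel n A b N x" and A: "A \<in> carrier_mat n n"
    and t: "t < n * N" and i: "i = t mod n" and pos: "0 < A $$ (i, i)"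
  shows "x (Suc (t div n)) $ i =
    sweep_point n x t $ i - ((A *\<^sub>v sweep_point n x t) $ i - b $ i) / A $$ (i, i)"
proof -
  let ?w = "sweep_point n x t"
  have "i < n" using t i by (cases n) auto
  have "(A *\<^sub>v ?w) $ i = (\<Sum>j<n. A $$ (i, j) * ?w $ j)"
    using A \<open>i < n\<close> sweep_point_carrier[of n x t] by (simp add: scalar_prod_def atLeast0LessThan)
  also have "{..<n} = {0..<i} \<union> {i} \<union> {Suc i..<n}" using \<open>i < n\<close> by auto
  also have "(\<Sum>j\<in>{0..<i} \<union> {i} \<union> {Suc i..<n}. A $$ (i, j) * ?w $ j) =
      (\<Sum>j\<in>{0..<i}. A $$ (i, j) * ?w $ j) + A $$ (i, i) * ?w $ i
      + (\<Sum>j\<in>{Suc i..<n}. A $$ (i, j) * ?w $ j)"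
    by (simp add: sum.union_disjoint)
  also have "(\<Sum>j\<in>{0..<i}. A $$ (i, j) * ?w $ j) =
      (\<Sum>j\<in>{0..<i}. A $$ (i, j) * x (Suc (t div n)) $ j)"
    using \<open>i < n\<close> by (intro sum.cong) (auto simp: sweep_point_def i)
  also have "(\<Sum>j\<in>{Suc i..<n}. A $$ (i, j) * ?w $ j) =
      (\<Sum>j\<in>{Suc i..<n}. A $$ (i, j) * x (t div n) $ j)"
    by (intro sum.cong) (auto simp: sweep_point_def i)
  finally have "(A *\<^sub>v ?w) $ i = (\<Sum>j\<in>{0..<i}. A $$ (i, j) * x (Suc (t div n)) $ j)
      + A $$ (i, i) * ?w $ i + (\<Sum>j\<in>{Suc i..<n}. A $$ (i, j) * x (t div n) $ j)" .
  moreover have "t div n < N" using t by (simp add: less_mult_imp_div_less mult.commute)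
  then have "x (Suc (t div n)) $ i = 1 / A $$ (i, i) *
      (b $ i - (\<Sum>j\<in>{0..<i}. A $$ (i, j) * x (Suc (t div n)) $ j)
             - (\<Sum>j\<in>{Suc i..<n}. A $$ (i, j) * x (t div n) $ j))"
    using iterates \<open>i < n\<close> unfolding gauss_seidel_def by blast
  ultimately show ?thesis using pos by (simp add: field_simps del: index_mult_mat_vec)
qed

lemma gauss_seidel_error_coordinate_descent:
  assumes iterates: "gauss_seidel n A (A *\<^sub>v z) N x" and A: "A \<in> carrier_mat n n"
    and z: "z \<in> carrier_vec n" and diagonal_pos: "\<And>i. i < n \<Longrightarrow> 0 < A $$ (i, i)"
  shows "cyclic_coordinate_descent n A (n * N) (\<lambda>t. sweep_point n x t - z)"
  unfolding cyclic_coordinate_descent_def Let_def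
proof (intro conjI allI impI)
  show "sweep_point n x 0 - z \<in> carrier_vec n" using z sweep_point_carrier by simp
  fix t assume t: "t < n * N"
  define i where "i = t mod n"
  have i_less: "i < n" using t by (cases n) (auto simp: i_def)
  let ?w = "sweep_point n x t"
  have "(A *\<^sub>v (?w - z)) $ i = (A *\<^sub>v ?w) $ i - (A *\<^sub>v z) $ i"
    using A i_less z sweep_point_carrier[of n x t]
    by (simp add: mult_minus_distrib_mat_vec[OF A] del: index_mult_mat_vec)
  then have "x (Suc (t div n)) $ i = ?w $ i - (A *\<^sub>v (?w - z)) $ i / A $$ (i, i)"
    using gauss_seidel_coordinate_update[OF iterates A t i_def diagonal_pos[OF i_less]] by simp
  then show "sweep_point n x (Suc t) - z = ?w - z
      - ((A *\<^sub>v (?w - z)) $ (t mod n) / A $$ (t mod n, t mod n)) \<cdot>\<^sub>v unit_vec n (t mod n)"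
    using z sweep_point_carrier[of n x] sweep_point_Suc_index[of _ n x t]
    by (intro eq_vecI) (auto simp: i_def carrier_vecD simp del: index_mult_mat_vec)
qed

section \<open>Rank-one feasible points of the performance estimation problem\<close>

definition rank_one_mat :: "real vec \<Rightarrow> real mat" where
  "rank_one_mat w = mat (dim_vec w) (dim_vec w) (\<lambda>(i, j). w $ i * w $ j)"

lemma inner_G_rank_one_mat:
  assumes "w \<in> carrier_vec p" "u \<in> carrier_vec p" "v \<in> carrier_vec p"
  shows "inner_G (rank_one_mat w) u v = (u \<bullet> w) * (v \<bullet> w)"
proof -
  have "rank_one_mat w *\<^sub>v v = (v \<bullet> w) \<cdot>\<^sub>v w"
    using assms by (intro eq_vecI)
      (auto simp: rank_one_mat_def scalar_prod_def sum_distrib_left ac_simps intro!: sum.cong)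
  then show ?thesis using assms by (simp add: inner_G_def)
qed

lemma psd_mat_rank_one_mat:
  assumes w: "w \<in> carrier_vec p"
  shows "psd_mat p (rank_one_mat w)"
proof -
  have "symmetric_mat p (rank_one_mat w)"
    using w by (auto simp: symmetric_mat_def rank_one_mat_def)
  then show ?thesis
    using inner_G_rank_one_mat[OF w] by (simp add: psd_mat_iff_inner_G_nonneg)
qed

lemma grad_iter_carrier: "grad_iter n N k i \<in> carrier_vec (pep_dim n N)"
  by (simp add: grad_iter_def)

lemma point_iter_carrier: "point_iter n N k i \<in> carrier_vec (pep_dim n N)"
  by (induction k) (auto simp: grad_iter_carrier)

lemma pep_x_carrier: "pep_x n N r i \<in> carrier_vec (pep_dim n N)"
  by (cases r) (simp_all add: point_iter_carrier)

lemma pep_g_carrier: "pep_g n N r i \<in> carrier_vec (pep_dim n N)"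
  by (cases r) (simp_all add: grad_iter_carrier)

lemma grad_iter_position_less_pep_dim:
  assumes "k \<le> pep_steps n N" "i < n"
  shows "n + k * n + i < pep_dim n N"
proof -
  have "n + k * n + i < n + (k + 1) * n" using assms by simp
  also have "\<dots> \<le> pep_dim n N"
    using mult_le_mono1[of "k + 1" "pep_steps n N + 1" n] assms
    by (simp add: pep_dim_def ac_simps)
  finally show ?thesis .
qed

locale unit_diagonal_descent =
  fixes n N :: nat and B :: "real mat" and y :: "nat \<Rightarrow> real vec"
  assumes psd: "psd_mat n B"
    and unit_diagonal: "\<And>i. i < n \<Longrightarrow> B $$ (i, i) = 1"
    and descent: "cyclic_coordinate_descent n B (pep_steps n N) y"
begin

definition point :: "pep_index \<Rightarrow> real vec" where
  "point r = (case r of Iter k \<Rightarrow> y k | Star \<Rightarrow> 0\<^sub>v n)"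

definition objective :: "pep_index \<Rightarrow> real" where
  "objective r = 1 / 2 * inner_G B (point r) (point r)"

definition gram_vec :: "real vec" where
  "gram_vec = vec (pep_dim n N)
     (\<lambda>m. if m < n then y 0 $ m else (B *\<^sub>v y ((m - n) div n)) $ ((m - n) mod n))"

abbreviation gram :: "real mat" where
  "gram \<equiv> rank_one_mat gram_vec"

lemma B_carrier: "B \<in> carrier_mat n n"
  using psd by (rule psd_mat_carrier)

lemma gram_vec_carrier: "gram_vec \<in> carrier_vec (pep_dim n N)"
  by (simp add: gram_vec_def)

lemma point_carrier: "r \<in> pep_indices n N \<Longrightarrow> point r \<in> carrier_vec n"
  using cyclic_coordinate_descent_carrier[OF descent] by (auto simp: point_def pep_indices_def)

lemma point_Suc:
  assumes "k < pep_steps n N"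
  shows "point (Iter (Suc k)) =
    point (Iter k) - (B *\<^sub>v point (Iter k)) $ (k mod n) \<cdot>\<^sub>v unit_vec n (k mod n)"
proof -
  have "k mod n < n" using assms by (cases n) (auto simp: pep_steps_def)
  then show ?thesis
    using descent assms unit_diagonal
    by (simp add: cyclic_coordinate_descent_def point_def Let_def)
qed

lemma grad_iter_scalar_prod_gram_vec:
  assumes "k \<le> pep_steps n N" "i < n"
  shows "grad_iter n N k i \<bullet> gram_vec = (B *\<^sub>v y k) $ i"
  using grad_iter_position_less_pep_dim[OF assms] assms
  by (simp add: grad_iter_def scalar_prod_left_unit[OF gram_vec_carrier] del: index_mult_mat_vec)
     (simp add: gram_vec_def add.assoc del: index_mult_mat_vec)

lemma point_iter_scalar_prod_gram_vec:
  assumes "k \<le> pep_steps n N" "i < n"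
  shows "point_iter n N k i \<bullet> gram_vec = y k $ i"
  using assms(1)
proof (induction k)
  case 0
  have "i < pep_dim n N" using assms(2) by (simp add: pep_dim_def)
  then show ?case
    using assms(2)
    by (simp add: scalar_prod_left_unit[OF gram_vec_carrier]) (simp add: gram_vec_def)
next
  case (Suc k)
  then have "y (Suc k) = y k - (B *\<^sub>v y k) $ (k mod n) \<cdot>\<^sub>v unit_vec n (k mod n)"
    using point_Suc[of k] by (simp add: point_def)
  then have "y (Suc k) $ i = (if i = k mod n then y k $ i - (B *\<^sub>v y k) $ i else y k $ i)"
    using assms(2) by (auto simp del: index_mult_mat_vec)
  then show ?case
    using Suc assms(2) grad_iter_scalar_prod_gram_vec[of k i]
    by (auto simp:
        minus_scalar_prod_distrib[OF point_iter_carrier grad_iter_carrier gram_vec_carrier])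
qed

lemma pep_x_scalar_prod_gram_vec:
  assumes "r \<in> pep_indices n N" "i < n"
  shows "pep_x n N r i \<bullet> gram_vec = point r $ i"
  using assms point_iter_scalar_prod_gram_vec gram_vec_carrier
  by (auto simp: pep_indices_def point_def)

lemma pep_g_scalar_prod_gram_vec:
  assumes "r \<in> pep_indices n N" "i < n"
  shows "pep_g n N r i \<bullet> gram_vec = (B *\<^sub>v point r) $ i"
  using assms grad_iter_scalar_prod_gram_vec gram_vec_carrier mult_mat_vec_zero[OF B_carrier]
  by (auto simp: pep_indices_def point_def simp del: index_mult_mat_vec)

lemma pep_x_diff_scalar_prod_gram_vec:
  assumes "r \<in> pep_indices n N" "s \<in> pep_indices n N" "i < n"
  shows "(pep_x n N r i - pep_x n N s i) \<bullet> gram_vec = (point r - point s) $ i"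
  using assms point_carrier[OF assms(2)]
  by (simp add: minus_scalar_prod_distrib[OF pep_x_carrier pep_x_carrier gram_vec_carrier]
      pep_x_scalar_prod_gram_vec)

lemma pep_g_diff_scalar_prod_gram_vec:
  assumes "r \<in> pep_indices n N" "s \<in> pep_indices n N" "i < n"
  shows "(pep_g n N r i - pep_g n N s i) \<bullet> gram_vec = (B *\<^sub>v (point r - point s)) $ i"
  using assms B_carrier
  by (simp add: minus_scalar_prod_distrib[OF pep_g_carrier pep_g_carrier gram_vec_carrier]
      pep_g_scalar_prod_gram_vec
      mult_minus_distrib_mat_vec[OF B_carrier point_carrier point_carrier]
      del: index_mult_mat_vec)

lemmas inner_G_gram = inner_G_rank_one_mat[OF gram_vec_carrier]

context
  fixes r s :: pep_index
  assumes r: "r \<in> pep_indices n N" and s: "s \<in> pep_indices n N"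
begin

lemma point_diff_carrier: "point r - point s \<in> carrier_vec n"
  using point_carrier[OF s] by (rule minus_carrier_vec[OF point_carrier[OF r]])

lemma mult_point_diff_carrier: "B *\<^sub>v (point r - point s) \<in> carrier_vec n"
  using B_carrier point_diff_carrier by (rule mult_mat_vec_carrier)

lemma sum_inner_G_pep_g_pep_x_diff:
  "(\<Sum>i<n. inner_G gram (pep_g n N s i) (pep_x n N r i - pep_x n N s i)) =
    (B *\<^sub>v point s) \<bullet> (point r - point s)"
  unfolding sum_index_eq_scalar_prod[OF point_diff_carrier, symmetric]
  by (intro sum.cong refl)
     (simp add: inner_G_gram pep_g_carrier pep_x_carrier pep_g_scalar_prod_gram_vec
      pep_x_diff_scalar_prod_gram_vec r s del: index_mult_mat_vec index_minus_vec)

lemma sum_inner_G_pep_g_diff_pep_x_diff: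
  "(\<Sum>i<n. inner_G gram (pep_g n N r i - pep_g n N s i) (pep_x n N r i - pep_x n N s i)) =
    inner_G B (point r - point s) (point r - point s)"
  unfolding inner_G_def[of B] comm_scalar_prod[OF point_diff_carrier mult_point_diff_carrier]
    sum_index_eq_scalar_prod[OF point_diff_carrier, symmetric]
  by (intro sum.cong refl)
     (simp add: inner_G_gram pep_g_carrier pep_x_carrier pep_g_diff_scalar_prod_gram_vec
      pep_x_diff_scalar_prod_gram_vec r s del: index_mult_mat_vec index_minus_vec)

lemma sum_inner_G_pep_g_diff:
  "(\<Sum>i<n. inner_G gram (pep_g n N r i - pep_g n N s i) (pep_g n N r i - pep_g n N s i)) =
    (B *\<^sub>v (point r - point s)) \<bullet> (B *\<^sub>v (point r - point s))"
  unfolding sum_index_eq_scalar_prod[OF mult_point_diff_carrier, symmetric]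
  by (intro sum.cong refl)
     (simp add: inner_G_gram pep_g_carrier pep_g_diff_scalar_prod_gram_vec r s
      del: index_mult_mat_vec index_minus_vec)

lemma objective_expand:
  "objective r = objective s + (B *\<^sub>v point s) \<bullet> (point r - point s)
    + 1 / 2 * inner_G B (point r - point s) (point r - point s)"
  unfolding objective_def
  by (rule half_inner_G_expand[OF psd_mat_imp_symmetric_mat[OF psd] point_carrier[OF r]
        point_carrier[OF s]])

lemma coord_smooth_ineq_unit_step:
  assumes i_less: "i < n" and step: "point r - point s = c \<cdot>\<^sub>v unit_vec n i"
  shows "coord_smooth_ineq n N gram objective i r s"
proof -
  have "B *\<^sub>v unit_vec n i = col B i" using B_carrier i_less by (intro eq_vecI) auto
  then have B_step: "B *\<^sub>v (c \<cdot>\<^sub>v unit_vec n i) = c \<cdot>\<^sub>v col B i"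
    by (simp add: mult_mat_vec[OF B_carrier])
  have "inner_G gram (pep_g n N r i - pep_g n N s i) (pep_g n N r i - pep_g n N s i) = c * c"
    using i_less B_carrier unit_diagonal
    by (simp add: inner_G_gram pep_g_carrier pep_g_diff_scalar_prod_gram_vec r s step B_step
        del: index_mult_mat_vec)
  moreover have "inner_G gram (pep_g n N s i) (pep_x n N r i - pep_x n N s i)
      = (B *\<^sub>v point s) $ i * c"
    using i_less by (simp add: inner_G_gram pep_g_carrier pep_x_carrier pep_g_scalar_prod_gram_vec
        pep_x_diff_scalar_prod_gram_vec r s step del: index_mult_mat_vec index_minus_vec)
  moreover have "objective r = objective s + (B *\<^sub>v point s) $ i * c + 1 / 2 * (c * c)"
    using objective_expand i_less B_carrier unit_diagonal
    by (simp add: step inner_G_def B_step del: index_mult_mat_vec)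
  ultimately show ?thesis by (simp add: coord_smooth_ineq_def)
qed

end

lemma pep_smooth_gram:
  assumes bound: "rayleigh_bound n B L"
  shows "pep_smooth n N L gram objective"
  unfolding pep_smooth_def
proof (intro ballI)
  fix r s assume rs: "r \<in> pep_indices n N" "s \<in> pep_indices n N"
  show "objective s + (\<Sum>i<n. inner_G gram (pep_g n N s i) (pep_x n N r i - pep_x n N s i))
      + 1 / (2 * L) * (\<Sum>i<n. inner_G gram (pep_g n N r i - pep_g n N s i)
          (pep_g n N r i - pep_g n N s i)) \<le> objective r"
    using psd_mat_cocoercive[OF psd bound point_diff_carrier[OF rs]] objective_expand[OF rs]
    unfolding sum_inner_G_pep_g_pep_x_diff[OF rs] sum_inner_G_pep_g_diff[OF rs] by simp
qed

lemma pep_quadratic_gram: "pep_quadratic n N gram objective"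
  unfolding pep_quadratic_def
proof (intro ballI)
  fix r s assume rs: "r \<in> pep_indices n N" "s \<in> pep_indices n N"
  show "1 / 2 * (\<Sum>i<n. inner_G gram (pep_g n N r i - pep_g n N s i)
          (pep_x n N r i - pep_x n N s i))
      = objective r - objective s
        - (\<Sum>i<n. inner_G gram (pep_g n N s i) (pep_x n N r i - pep_x n N s i))"
    using objective_expand[OF rs]
    unfolding sum_inner_G_pep_g_diff_pep_x_diff[OF rs] sum_inner_G_pep_g_pep_x_diff[OF rs] by simp
qed

lemma pep_coord_smooth_gram: "pep_coord_smooth n N gram objective"
  unfolding pep_coord_smooth_def
proof (intro allI impI)
  fix k assume k_less: "k < pep_steps n N"
  have i_less: "k mod n < n" using k_less by (cases n) (auto simp: pep_steps_def)
  have indices: "Iter k \<in> pep_indices n N" "Iter (Suc k) \<in> pep_indices n N"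
    using k_less by (auto simp: pep_indices_def)
  define c where "c = (B *\<^sub>v point (Iter k)) $ (k mod n)"
  have "point (Iter (Suc k)) = point (Iter k) - c \<cdot>\<^sub>v unit_vec n (k mod n)"
    using point_Suc[OF k_less] by (simp add: c_def)
  then have "point (Iter k) - point (Iter (Suc k)) = c \<cdot>\<^sub>v unit_vec n (k mod n)"
    and "point (Iter (Suc k)) - point (Iter k) = (- c) \<cdot>\<^sub>v unit_vec n (k mod n)"
    using point_carrier[OF indices(1)] by (auto simp: vec_eq_iff)
  then show "coord_smooth_ineq n N gram objective (k mod n) (Iter k) (Iter (Suc k)) \<and>
      coord_smooth_ineq n N gram objective (k mod n) (Iter (Suc k)) (Iter k)"
    using coord_smooth_ineq_unit_step i_less indices by blast
qed

lemma pep_initial_gram: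
  assumes "y 0 \<bullet> y 0 \<le> \<Delta>"
  shows "pep_initial n N \<Delta> gram"
proof -
  have init: "Iter 0 \<in> pep_indices n N" by (simp add: pep_indices_def)
  have "(\<Sum>i<n. inner_G gram (pep_x n N (Iter 0) i) (pep_x n N (Iter 0) i))
      = (\<Sum>i<n. point (Iter 0) $ i * point (Iter 0) $ i)"
    using pep_x_carrier
    by (intro sum.cong refl)
       (simp add: inner_G_gram pep_x_scalar_prod_gram_vec[OF init] del: pep_x.simps)
  also have "\<dots> = y 0 \<bullet> y 0"
    using sum_index_eq_scalar_prod[OF point_carrier[OF init]] by (simp add: point_def)
  finally show ?thesis using assms by (simp add: pep_initial_def)
qed

lemma half_inner_G_le_pep_val:
  assumes "rayleigh_bound n B L" and "y 0 \<bullet> y 0 \<le> \<Delta>"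
  shows "ereal (1 / 2 * inner_G B (y (pep_steps n N)) (y (pep_steps n N))) \<le> pep_val n N L \<Delta>"
proof -
  have "pep_feasible n N L \<Delta> gram objective"
    unfolding pep_feasible_def
    using psd_mat_rank_one_mat[OF gram_vec_carrier] pep_smooth_gram[OF assms(1)] pep_quadratic_gram
      pep_coord_smooth_gram pep_initial_gram[OF assms(2)] by blast
  then have "ereal (objective (Iter (pep_steps n N)) - objective Star) \<le> pep_val n N L \<Delta>"
    unfolding pep_val_def by (intro Sup_upper) blast
  moreover have "objective Star = 0"
    by (simp add: objective_def point_def inner_G_def mult_mat_vec_zero[OF B_carrier])
  ultimately show ?thesis by (simp add: objective_def point_def)
qed

end

lemma cyclic_coordinate_descent_le_pep_val:
  assumes A: "psd_mat n A" and diagonal_pos: "\<And>i. i < n \<Longrightarrow> 0 < A $$ (i, i)"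
    and n_pos: "0 < n" and error_descent: "cyclic_coordinate_descent n A (pep_steps n N) e"
    and init: "(norm_D A (e 0))\<^sup>2 \<le> \<Delta>"
  shows "ereal (1 / 2 * inner_G A (e (pep_steps n N)) (e (pep_steps n N)))
    \<le> pep_val n N (lambda_max (the (mat_inverse (diag_part A)) * A)) \<Delta>"
proof -
  note A_carrier = psd_mat_carrier[OF A]
    and e_carrier = cyclic_coordinate_descent_carrier[OF error_descent]
  have B_psd: "psd_mat n (jacobi_scaled A)"
    using psd_mat_congruence[OF A inv_sqrt_diag_carrier[OF A_carrier]]
    by (simp add: jacobi_scaled_eq_congruence)
  interpret unit_diagonal_descent n N "jacobi_scaled A" "\<lambda>k. sqrt_diag A *\<^sub>v e k"
    using B_psd jacobi_scaled_diagonal[OF A_carrier diagonal_pos]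
      cyclic_coordinate_descent_jacobi_scaled[OF A_carrier diagonal_pos n_pos error_descent]
    by unfold_locales
  have "rayleigh_bound n (jacobi_scaled A) (lambda_max (the (mat_inverse (diag_part A)) * A))"
    using rayleigh_bound_lambda_max[OF psd_mat_imp_symmetric_mat[OF B_psd] n_pos]
    by (simp add: lambda_max_jacobi_scaled[OF A_carrier diagonal_pos])
  moreover have "(sqrt_diag A *\<^sub>v e 0) \<bullet> (sqrt_diag A *\<^sub>v e 0) \<le> \<Delta>"
    using init e_carrier[of 0] by (simp add: norm_D_square[OF A_carrier diagonal_pos])
  ultimately show ?thesis
    using half_inner_G_le_pep_val e_carrier[of "pep_steps n N"]
    by (simp add: inner_G_jacobi_scaled[OF A_carrier diagonal_pos])
qed

theorem theorem3p2:
  fixes n N :: nat and A :: "real mat" and b xstar :: "real vec"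
    and x :: "nat \<Rightarrow> real vec" and L \<Delta> :: real
  assumes "n \<ge> 1" and "N \<ge> 1"
    and "psd_mat n A"
    and "\<And>i. i < n \<Longrightarrow> A $$ (i, i) > 0"
    and "b \<in> carrier_vec n"
    and "xstar \<in> carrier_vec n" and "A *\<^sub>v xstar = b"
    and "L = lambda_max (the (mat_inverse (diag_part A)) * A)"
    and "\<Delta> \<ge> 0"
    and "(norm_D A (x 0 - xstar))\<^sup>2 \<le> \<Delta>"
    and "gauss_seidel n A b N x"
  shows "ereal (quad_fun A b (x N) - quad_fun A b xstar) \<le> pep_val n N L \<Delta>"
proof -
  note A = psd_mat_carrier[OF assms(3)]
  define e where "e = (\<lambda>t. sweep_point n x t - xstar)"
  have x: "x k \<in> carrier_vec n" if "k \<le> N" for k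
    using assms(11) that by (simp add: gauss_seidel_def)
  have e_start: "e 0 = x 0 - xstar" and e_end: "e (pep_steps n N) = x N - xstar"
    using sweep_point_full_sweep[of x 0 n] sweep_point_full_sweep[of x N n] x
    by (simp_all add: e_def pep_steps_def)
  have descent: "cyclic_coordinate_descent n A (pep_steps n N) e"
    using gauss_seidel_error_coordinate_descent[of n A xstar N x] assms(4,6,7,11) A
    by (simp add: e_def pep_steps_def)
  have "ereal (1 / 2 * inner_G A (x N - xstar) (x N - xstar)) \<le> pep_val n N L \<Delta>"
    using cyclic_coordinate_descent_le_pep_val[OF assms(3,4) _ descent, of \<Delta>] assms(1,8,10)
    by (simp add: e_start e_end)
  moreover have "quad_fun A b (x N) - quad_fun A b xstar
      = 1 / 2 * inner_G A (x N - xstar) (x N - xstar)"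
    using quad_fun_minus_stationary[OF psd_mat_imp_symmetric_mat[OF assms(3)] x[of N] assms(6)]
    by (simp only: assms(7) order_refl)
  ultimately show ?thesis by (simp only:)
qed

end
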